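(* For every integer $n \ge 1$, $\lambda(n) \le 2\sqrt{n}$.
   Context: All posets are finite. A linear extension of a poset $P=(X,\preceq)$ is a total ordering of $X$ compatible with $\preceq$; $e(P)$ denotes the number of linear extensions of $P$. The size $|P|$ of $P$ is $|X|$. For an integer $n\ge 1$, $\lambda(n)=\min\{|P| : e(P)=n\}$ (the empty poset has exactly one linear extension, so $\lambda(1)=0$). *)

theory Defs
  imports Complex_Main
begin

(* A poset is a carrier X with its reflexive order relation r; partial_order_on includes
   r \<subseteq> X \<times> X, so a finite X has only finitely many linear extensions. *)

definition linear_extensions :: "'a set \<Rightarrow> 'a rel \<Rightarrow> 'a rel set" where
  "linear_extensions X r = {L. linear_order_on X L \<and> r \<subseteq> L}"

definition num_linear_extensions :: "'a set \<Rightarrow> 'a rel \<Rightarrow> nat" where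
  "num_linear_extensions X r = card (linear_extensions X r)"

(* Carriers range over finite subsets of nat: every finite poset is isomorphic to such a poset.
   LEAST is the minimum when some poset qualifies, and is unspecified otherwise (n = 0). *)

definition min_poset_size :: "nat \<Rightarrow> nat" where
  "min_poset_size n =
     (LEAST k. \<exists>(X :: nat set) r. finite X \<and> partial_order_on X r \<and>
                 card X = k \<and> num_linear_extensions X r = n)"

end

theory Submission
  imports Defs "HOL-Library.Discrete_Functions"
begin

text \<open>
  Take a chain of \<open>m\<close> elements and insert two further, mutually incomparable elements \<open>x\<close> and \<open>y\<close>,
  where \<open>x\<close> may occupy any of \<open>a\<close> consecutive gaps of the chain and \<open>y\<close> any of \<open>b\<close>.
  If exactly \<open>c \<ge> 1\<close> gaps are available to both and every gap is available to one of them, this poset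
  has \<open>a + b - c + 1\<close> elements and \<open>a * b + c\<close> linear extensions, since the two elements can be
  arranged in two ways when they share a gap. Every \<open>n \<ge> 2\<close> is \<open>a * b + c\<close> with
  \<open>(a, b) = (k - 1, k + 1)\<close>, \<open>(k, k)\<close> or \<open>(k, k + 1)\<close>, where \<open>k\<close> is the integer part of
  the square root of \<open>n\<close>.
\<close>

text \<open>The chain is \<open>{..<m}\<close>, and \<open>x = m\<close>, \<open>y = Suc m\<close>. Gap \<open>g\<close> is the position directly above exactly
  \<open>g\<close> chain elements: \<open>x\<close> is confined to gaps \<open>0..p\<close> and \<open>y\<close> to gaps \<open>s..m\<close>.\<close>

definition two_point_order :: "nat \<Rightarrow> nat \<Rightarrow> nat \<Rightarrow> nat rel" where
  "two_point_order m p s = {(i, j). i = j \<and> j < m + 2 \<or> i \<le> j \<and> j < m \<or>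
     i = m \<and> p \<le> j \<and> j < m \<or> i < s \<and> j = Suc m}"

text \<open>The flag must be \<open>False\<close> when the gaps differ, so that no linear extension
  is encoded twice.\<close>

definition placements :: "nat \<Rightarrow> nat \<Rightarrow> nat \<Rightarrow> (nat \<times> nat \<times> bool) set" where
  "placements m p s = {(a, b, e). a \<le> p \<and> s \<le> b \<and> b \<le> m \<and> (e \<longrightarrow> a = b)}"

text \<open>The offsets modulo 4 put \<open>x\<close> and \<open>y\<close> below the chain element that closes their gap;
  in a common gap \<open>e\<close> says whether \<open>x\<close> comes before \<open>y\<close>.\<close>

fun placement_key :: "nat \<Rightarrow> nat \<times> nat \<times> bool \<Rightarrow> nat \<Rightarrow> nat" where
  "placement_key m (a, b, e) i =
     (if i < m then 4 * i + 3 else if i = m then 4 * a + 1 else 4 * b + (if e then 2 else 0))"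

definition placement_order :: "nat \<Rightarrow> nat \<times> nat \<times> bool \<Rightarrow> nat rel" where
  "placement_order m c =
     {(i, j). i < m + 2 \<and> j < m + 2 \<and> placement_key m c i \<le> placement_key m c j}"

lemma partial_order_two_point_order:
  assumes "s \<le> p" "p \<le> m"
  shows "partial_order_on {..<m + 2} (two_point_order m p s)"
  using assms
  by (auto simp: order_on_defs refl_on_def trans_def antisym_def two_point_order_def)

lemma linear_order_on_key:
  fixes f :: "'a \<Rightarrow> 'b::linorder"
  assumes "inj_on f X"
  shows "linear_order_on X {(i, j). i \<in> X \<and> j \<in> X \<and> f i \<le> f j}"
  using assms
  by (auto simp: order_on_defs refl_on_def total_on_def intro!: transI antisymI dest: inj_onD)

text \<open>Keys of chain elements are 3 modulo 4, that of \<open>m\<close> is 1, and that of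
  \<open>Suc m\<close> is even.\<close>

lemma inj_on_placement_key: "inj_on (placement_key m c) {..<m + 2}"
proof (cases c)
  case (fields a b e)
  show ?thesis
    unfolding fields by (rule inj_onI) (simp split: if_splits; presburger)
qed

lemma placement_order_linear_extension:
  assumes "c \<in> placements m p s"
  shows "placement_order m c \<in> linear_extensions {..<m + 2} (two_point_order m p s)"
  using assms linear_order_on_key[OF inj_on_placement_key[of m c]]
  by (auto simp: linear_extensions_def placement_order_def placements_def two_point_order_def)

text \<open>The two gaps can be read off the order as the numbers of chain elements below
  \<open>m\<close> and \<open>Suc m\<close>; in a common gap the flag is the comparison of these
  two.\<close>

lemma inj_on_placement_order:
  assumes "p \<le> m"
  shows "inj_on (placement_order m) (placements m p s)"
proof (rule inj_onI)
  fix c d assume c: "c \<in> placements m p s" and d: "d \<in> placements m p s"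
    and eq: "placement_order m c = placement_order m d"
  obtain a b e a' b' e' where [simp]: "c = (a, b, e)" "d = (a', b', e')"
    by (metis prod_cases3)
  have le: "a \<le> m" "a' \<le> m" "b \<le> m" "b' \<le> m"
    using c d assms by (auto simp: placements_def)
  have E: "(i, j) \<in> placement_order m c \<longleftrightarrow> (i, j) \<in> placement_order m d" for i j
    by (simp only: eq)
  have A: "j < a \<longleftrightarrow> j < a'" if "j < m" for j
  proof -
    have "4 * j + 3 \<le> 4 * a + 1 \<longleftrightarrow> 4 * j + 3 \<le> 4 * a' + 1"
      using E[of j m] that by (simp add: placement_order_def)
    then show ?thesis by presburger
  qed
  have B: "j < b \<longleftrightarrow> j < b'" if "j < m" for j
  proof -
    have "4 * j + 3 \<le> 4 * b + (if e then 2 else 0) \<longleftrightarrow> 4 * j + 3 \<le> 4 * b' + (if e' then 2 else 0)"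
      using E[of j "Suc m"] that by (simp add: placement_order_def)
    then show ?thesis by (simp split: if_splits; presburger)
  qed
  have "a = a'" "b = b'"
    using A[of a] A[of a'] B[of b] B[of b'] le by linarith+
  moreover have "e = e'"
    using E[of m "Suc m"] c d calculation
    by (auto simp: placement_order_def placements_def split: if_splits)
  ultimately show "c = d" by simp
qed

section \<open>Every linear extension comes from a placement\<close>

lemma down_closed_threshold:
  fixes P :: "nat \<Rightarrow> bool"
  assumes "\<And>i j. i \<le> j \<Longrightarrow> j < m \<Longrightarrow> P j \<Longrightarrow> P i"
  shows "\<exists>a\<le>m. \<forall>j<m. P j \<longleftrightarrow> j < a"
proof -
  let ?a = "LEAST j. j = m \<or> \<not> P j"
  have 1: "?a = m \<or> \<not> P ?a" by (rule LeastI[of _ m]) simp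
  have 2: "?a \<le> m" by (rule Least_le) simp
  have "P j \<longleftrightarrow> j < ?a" if "j < m" for j
    using 1 assms[of ?a j] that not_less_Least[of j "\<lambda>j. j = m \<or> \<not> P j"] by fastforce
  with 2 show ?thesis by blast
qed

text \<open>By totality of \<open>L\<close>, a pair missing from \<open>L\<close> occurs there
  reversed, which antisymmetry of \<open>M\<close> forbids. Hence one inclusion suffices
  below.\<close>

lemma linear_order_on_eq_if_subset:
  assumes "linear_order_on X L" "linear_order_on X M" "L \<subseteq> M"
  shows "L = M"
proof
  show "M \<subseteq> L"
  proof clarify
    fix i j assume "(i, j) \<in> M"
    moreover from this have "i \<in> X" "j \<in> X"
      using assms(2) by (auto simp: order_on_defs)
    ultimately show "(i, j) \<in> L"
      using assms antisymD[of M i j]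
      unfolding order_on_defs refl_on_def total_on_def by (cases "i = j") blast+
  qed
qed (fact assms)

lemma linear_extension_is_placement_order:
  assumes "s \<le> p" "p \<le> m" and L: "L \<in> linear_extensions {..<m + 2} (two_point_order m p s)"
  shows "\<exists>c\<in>placements m p s. L = placement_order m c"
proof -
  have lin: "linear_order_on {..<m + 2} L" and sub: "two_point_order m p s \<subseteq> L"
    using L by (auto simp: linear_extensions_def)
  have tr: "(i, k) \<in> L" if "(i, j) \<in> L" "(j, k) \<in> L" for i j k
    using lin that by (auto simp: order_on_defs dest: transD)
  have anti: "i = j" if "(i, j) \<in> L" "(j, i) \<in> L" for i j
    using lin that by (auto simp: order_on_defs dest: antisymD)
  have tot: "(i, j) \<in> L \<or> (j, i) \<in> L" if "i < m + 2" "j < m + 2" for i j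
    using lin that by (cases "i = j") (auto simp: order_on_defs refl_on_def total_on_def)
  have ch: "(i, j) \<in> L" if "i \<le> j" "j < m" for i j
    using sub that by (auto simp: two_point_order_def)
  \<comment> \<open>The chain elements below \<open>m\<close> form an initial segment, whose length
    is the gap of \<open>m\<close>; likewise for \<open>Suc m\<close>.\<close>
  obtain a where a: "a \<le> m" "\<And>j. j < m \<Longrightarrow> (j, m) \<in> L \<longleftrightarrow> j < a"
    using down_closed_threshold[of m "\<lambda>j. (j, m) \<in> L"] ch tr by blast
  obtain b where b: "b \<le> m" "\<And>j. j < m \<Longrightarrow> (j, Suc m) \<in> L \<longleftrightarrow> j < b"
    using down_closed_threshold[of m "\<lambda>j. (j, Suc m) \<in> L"] ch tr by blast
  have xa: "(m, j) \<in> L" if "a \<le> j" "j < m" for j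
    using a(2)[of j] tot[of j m] that by auto
  have yb: "(Suc m, j) \<in> L" if "b \<le> j" "j < m" for j
    using b(2)[of j] tot[of j "Suc m"] that by auto
  have "a \<le> p"
  proof (rule ccontr)
    assume "\<not> a \<le> p"
    then have "(p, m) \<in> L" "(m, p) \<in> L" "p < m"
      using a sub by (auto simp: two_point_order_def)
    then show False using anti by blast
  qed
  have "s \<le> b"
  proof (rule ccontr)
    assume "\<not> s \<le> b"
    then have "(b, Suc m) \<in> two_point_order m p s" "b < m"
      using assms(1,2) by (auto simp: two_point_order_def)
    then have "(b, Suc m) \<in> L" "b < m"
      using sub by blast+
    then show False using b(2) by blast
  qed
  define c where "c = (a, b, a = b \<and> (m, Suc m) \<in> L)"
  have c: "c \<in> placements m p s"
    using \<open>a \<le> p\<close> \<open>s \<le> b\<close> b(1) by (simp add: c_def placements_def)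
  \<comment> \<open>The chain element \<open>a\<close> separates the two points.\<close>
  have xy: "(m, Suc m) \<in> L" if "a < b"
    using tr[of m a "Suc m"] xa[of a] b that by auto
  have yx: "(Suc m, m) \<in> L" if "b < a"
    using tr[of "Suc m" b m] yb[of b] a that by auto
  have rf: "(i, i) \<in> L" if "i < m + 2" for i
    using tot that by blast
  have "placement_order m c \<subseteq> L"
  proof clarify
    fix i j assume "(i, j) \<in> placement_order m c"
    then have ij: "i < m + 2" "j < m + 2" and k: "placement_key m c i \<le> placement_key m c j"
      by (auto simp: placement_order_def)
    consider "i < m" | "i = m" | "i = Suc m" using ij by linarith
    then show "(i, j) \<in> L"
    proof cases
      case 1
      consider "j < m" | "j = m" | "j = Suc m" using ij by linarith
      then show ?thesis
        using 1 k a(2)[of i] b(2)[of i] ch[of i j] by cases (auto simp: c_def split: if_splits)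
    next
      case 2
      consider "j < m" | "j = m" | "j = Suc m" using ij by linarith
      then show ?thesis
        using 2 k xa[of j] xy rf[of m] by cases (auto simp: c_def split: if_splits)
    next
      case 3
      consider "j < m" | "j = m" | "j = Suc m" using ij by linarith
      then show ?thesis
        using 3 k yb[of j] yx rf[of "Suc m"] tot[of m "Suc m"]
        by cases (auto simp: c_def split: if_splits)
    qed
  qed
  moreover have "linear_order_on {..<m + 2} (placement_order m c)"
    using placement_order_linear_extension[OF c] by (simp add: linear_extensions_def)
  ultimately show ?thesis
    using linear_order_on_eq_if_subset lin c by metis
qed

section \<open>Counting, and the bound on the size\<close>

lemma card_placements:
  assumes "s \<le> p" "p \<le> m"
  shows "card (placements m p s) = Suc p * (Suc m - s) + (Suc p - s)"
proof -
  \<comment> \<open>Flag \<open>False\<close> allows any pair of gaps, flag \<open>True\<close> only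
    the common gaps \<open>s\<close> to \<open>p\<close>.\<close>
  have eq: "placements m p s =
      {..p} \<times> {s..m} \<times> {False} \<union> (\<lambda>a. (a, a, True)) ` {s..p}"
    using assms by (auto simp: placements_def)
  have "card ((\<lambda>a::nat. (a, a, True)) ` {s..p}) = Suc p - s"
    by (subst card_image) (auto simp: inj_on_def)
  then show ?thesis
    unfolding eq by (subst card_Un_disjoint) (auto simp: card_cartesian_product)
qed

lemma num_linear_extensions_two_point_order:
  assumes "s \<le> p" "p \<le> m"
  shows "num_linear_extensions {..<m + 2} (two_point_order m p s)
    = Suc p * (Suc m - s) + (Suc p - s)"
proof -
  have "linear_extensions {..<m + 2} (two_point_order m p s)
      = placement_order m ` placements m p s"
    using linear_extension_is_placement_order[OF assms] placement_order_linear_extension by blast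
  then show ?thesis
    using card_image[OF inj_on_placement_order] card_placements assms
    by (simp add: num_linear_extensions_def)
qed

lemma min_poset_size_le:
  fixes X :: "nat set"
  assumes "finite X" "partial_order_on X r" "num_linear_extensions X r = n"
  shows "min_poset_size n \<le> card X"
  unfolding min_poset_size_def using assms by (intro Least_le) blast

text \<open>Here \<open>s + t + 1\<close> gaps are available to \<open>x\<close>, \<open>t + u + 1\<close> to \<open>y\<close>, and \<open>t + 1\<close> to both.\<close>

lemma min_poset_size_mult_add_le:
  "min_poset_size ((s + t + 1) * (t + u + 1) + (t + 1)) \<le> s + t + u + 2"
  using min_poset_size_le[OF _ partial_order_two_point_order[of s "s + t" "s + t + u"]
      num_linear_extensions_two_point_order[of s "s + t" "s + t + u"]]
  by (simp add: Suc_diff_le)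

lemma min_poset_size_1: "min_poset_size 1 = 0"
proof -
  have "linear_extensions ({} :: nat set) {} = {{}}"
    by (auto simp: linear_extensions_def order_on_defs refl_on_def)
  then show ?thesis
    using min_poset_size_le[of "{}" "{}" 1]
    by (auto simp: num_linear_extensions_def order_on_defs refl_on_def)
qed

lemma min_poset_size_square_le:
  assumes "n \<ge> 1"
  shows "(min_poset_size n)\<^sup>2 \<le> 4 * n"
proof -
  define k where "k = floor_sqrt n"
  have k: "k\<^sup>2 \<le> n" "n < (Suc k)\<^sup>2"
    using Suc_floor_sqrt_power2_gt by (simp_all add: k_def)
  have "n = k\<^sup>2 \<or> (k\<^sup>2 < n \<and> n \<le> k\<^sup>2 + k) \<or> (k\<^sup>2 + k < n \<and> n \<le> k\<^sup>2 + k + k)"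
    using k by (auto simp: power2_eq_square)
  \<comment> \<open>For \<open>k = 1\<close> the choice of \<open>k - 1\<close> gaps would leave
    none, so 1 is treated apart, by the empty poset.\<close>
  then consider "n = 1" | "n = k\<^sup>2" "k \<ge> 2"
    | "k\<^sup>2 < n" "n \<le> k\<^sup>2 + k" | "k\<^sup>2 + k < n" "n \<le> k\<^sup>2 + k + k"
    using assms by (cases "k \<ge> 2") (auto simp: not_le less_2_cases_iff)
  then show ?thesis
  proof cases
    case 1
    then show ?thesis using min_poset_size_1 by simp
  next
    case 2
    then obtain s where s: "k = s + 2" by (metis add.commute le_Suc_ex)
    \<comment> \<open>This is k * k = (k - 1) * (k + 1) + 1, with a single common gap.\<close>
    then have "n = (s + 0 + 1) * (0 + k + 1) + (0 + 1)"
      using 2 by (simp add: power2_eq_square algebra_simps)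
    then have "min_poset_size n \<le> 2 * k"
      using min_poset_size_mult_add_le[of s 0 k] s by simp
    then have "(min_poset_size n)\<^sup>2 \<le> (2 * k)\<^sup>2" by (rule power_mono) simp
    then show ?thesis using 2 by (simp add: power_mult_distrib)
  next
    case 3
    then obtain t where t: "n = k\<^sup>2 + t + 1"
      using less_imp_Suc_add[OF 3(1)] by auto
    then obtain s where s: "k = s + t + 1"
      using 3 by (metis Suc_eq_plus1 add.assoc add.commute add_le_cancel_left le_Suc_ex)
    have "n = (s + t + 1) * (t + s + 1) + (t + 1)"
      using t s by (simp add: power2_eq_square algebra_simps)
    then have "min_poset_size n \<le> 2 * k"
      using min_poset_size_mult_add_le[of s t s] s by simp
    then have "(min_poset_size n)\<^sup>2 \<le> (2 * k)\<^sup>2" by (rule power_mono) simp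
    then show ?thesis using 3 by (simp add: power_mult_distrib)
  next
    case 4
    then obtain t where t: "n = k\<^sup>2 + k + t + 1"
      using less_imp_Suc_add[OF 4(1)] by auto
    then obtain s where s: "k = s + t + 1"
      using 4 by (metis Suc_eq_plus1 add.assoc add.commute add_le_cancel_left le_Suc_ex)
    have "n = (s + t + 1) * (t + (s + 1) + 1) + (t + 1)"
      using t s by (simp add: power2_eq_square algebra_simps)
    then have "min_poset_size n \<le> 2 * k + 1"
      using min_poset_size_mult_add_le[of s t "s + 1"] s by simp
    then have "(min_poset_size n)\<^sup>2 \<le> (2 * k + 1)\<^sup>2" by (rule power_mono) simp
    \<comment> \<open>The extra element is affordable because \<open>n\<close> is at least k * k + k
      + 1, while the left side is 4 * (k * k + k) + 1.\<close>
    also have "\<dots> \<le> 4 * n" using t by (simp add: power2_eq_square algebra_simps)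
    finally show ?thesis .
  qed
qed

theorem theorem3p2:
  fixes n :: nat
  assumes "n \<ge> 1"
  shows "real (min_poset_size n) \<le> 2 * sqrt (real n)"
proof -
  have "real (min_poset_size n) \<le> sqrt (real (4 * n))"
    using min_poset_size_square_le[OF assms]
    by (intro real_le_rsqrt) (metis of_nat_le_iff of_nat_power)
  then show ?thesis by (simp add: real_sqrt_mult)
qed

end
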